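(* Fix $\beta>0$ and let $\eta\mapsto\lambda(\eta)$, $\eta\in(0,1)$, be the function defined in the context. There is a $\lambda_+>0$ such that, for any positive $\lambda<\lambda_+$, there are at least two different values $\eta=\eta_-(\lambda)$ and $\eta=\eta_+(\lambda)$ in $(0,1)$ satisfying the relation $\lambda(\eta)=\lambda$ and such that $\eta_-(\lambda)\to0$ and $\eta_+(\lambda)\to1$ as $\lambda\to0$.
   Context: A queue state is a finite sequence $(n_1,\dots,n_l)$, $l\ge0$, of integers. For a probability measure $\mu$ on the countable set of queue states, define $$\nu_k(\mu)=\begin{cases}\sum_{\mathcal N}\mu(k+1,\mathcal N)&k>0,\\ \sum_{\mathcal N}\mu(k-1,\mathcal N)&k<0,\\ 0&k=0,\end{cases}$$ where $\mathcal N$ runs over all finite integer sequences and $(m,\mathcal N)$ denotes the sequence with first element $m$ followed by $\mathcal N$. Consider, for $\lambda$ and $\mu$, the system consisting of the symmetry $\nu_k(\mu)=\nu_{-k}(\mu)$ for all $k\in\mathbb{Z}$ and, for every $l\ge0$ and $(n_1,\dots,n_l)\in\mathbb{Z}^l$, $$\mu(n_1,\dots,n_{l-1})\left[\nu_{n_l}(\mu)+\lambda\delta(n_l,0)\right]-\mu(n_1,\dots,n_l)\Big(\sum_{k\ne0}\nu_k(\mu)+\lambda\Big)+\sum_{k}\mu(k,n_1,\dots,n_l)-\mu(n_1,\dots,n_l)\mathbb{I}_{l\ne0}$$ $$+\beta\left[\mu(n_1+1,\dots,n_l+1)+\mu(n_1-1,\dots,n_l-1)-2\mu(n_1,\dots,n_l)\right]=0,$$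 where $\delta$ is the Kronecker delta and for $l=0$ the first term is absent. For every $\eta\in(0,1)$ there is a unique pair $(\lambda(\eta),\mu_\eta)$, with $\mu_\eta$ a probability measure on queue states, which solves this system and satisfies $\sum_{k\ne0}\nu_k(\mu_\eta)+\lambda(\eta)=\eta$; this defines the function $\lambda(\eta)$. *)

theory Defs
  imports "HOL-Probability.Probability"
begin

(* A queue state (n_1,...,n_l) is the list [n_1,...,n_l]; the head of the list is n_1.
   Since the state space int list is countable, a probability measure on it is a pmf.
   Every infinite sum below ranges, without repetition, over values of a pmf,
   so it converges absolutely. *)

type_synonym queue_state = "int list"

definition nu :: "queue_state pmf \<Rightarrow> int \<Rightarrow> real" where
  "nu \<mu> k =
     (if k > 0 then \<Sum>\<^sub>\<infinity>N. pmf \<mu> ((k + 1) # N)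
      else if k < 0 then \<Sum>\<^sub>\<infinity>N. pmf \<mu> ((k - 1) # N)
      else 0)"

definition inflow :: "real \<Rightarrow> queue_state pmf \<Rightarrow> real" where
  "inflow lam \<mu> = (\<Sum>\<^sub>\<infinity>k\<in>{k. k \<noteq> 0}. nu \<mu> k) + lam"

definition balance :: "real \<Rightarrow> real \<Rightarrow> queue_state pmf \<Rightarrow> queue_state \<Rightarrow> real" where
  "balance \<beta> lam \<mu> ns =
     (if ns = [] then 0
      else pmf \<mu> (butlast ns) * (nu \<mu> (last ns) + lam * of_bool (last ns = 0)))
     - pmf \<mu> ns * inflow lam \<mu>
     + (\<Sum>\<^sub>\<infinity>k. pmf \<mu> (k # ns))
     - pmf \<mu> ns * of_bool (ns \<noteq> [])
     + \<beta> * (pmf \<mu> (map (\<lambda>n. n + 1) ns) + pmf \<mu> (map (\<lambda>n. n - 1) ns) - 2 * pmf \<mu> ns)"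

definition solves_system :: "real \<Rightarrow> real \<Rightarrow> queue_state pmf \<Rightarrow> bool" where
  "solves_system \<beta> lam \<mu> \<longleftrightarrow>
     (\<forall>k. nu \<mu> k = nu \<mu> (- k)) \<and> (\<forall>ns. balance \<beta> lam \<mu> ns = 0)"

(* For 0 < \<eta> < 1 and \<beta> > 0 the pair picked out by THE exists and is unique;
   lam ranges over all reals, without a sign constraint. *)

definition solution_pair :: "real \<Rightarrow> real \<Rightarrow> real \<times> queue_state pmf" where
  "solution_pair \<beta> \<eta> = (THE p. solves_system \<beta> (fst p) (snd p) \<and> inflow (fst p) (snd p) = \<eta>)"

definition lambda_of :: "real \<Rightarrow> real \<Rightarrow> real" where
  "lambda_of \<beta> \<eta> = fst (solution_pair \<beta> \<eta>)"

end

theory Submission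
  imports Defs
begin

text \<open>
  Put \<open>x k = \<nu>\<^sub>k + \<lambda>\<delta>(k, 0)\<close>, which has total mass \<open>\<eta>\<close>. For fixed rates \<open>x\<close> the system is linear
  and describes a FIFO queue with arrivals at total rate \<open>\<eta>\<close>, unit service rate and marks that
  perform a common random walk. The queue length is therefore geometric, and pairing the system with
  the events that position \<open>j\<close> carries the mark \<open>k\<close>, together with a maximum principle, shows that
  the law \<open>q\<close> of the first mark satisfies \<open>(1 - \<eta>)(q - x) = \<beta>\<Delta>q\<close>. Since \<open>x k = q (k \<plusminus> 1)\<close> for
  \<open>k \<noteq> 0\<close>, this is a second order recursion on each half-line; its summable solution is
  \<open>q k = q\<^sub>0 r\<^bsup>\<bar>k\<bar>\<^esup>\<close> with \<open>r = \<beta> / (\<beta> + 1 - \<eta>)\<close>, and the mass condition fixes \<open>q\<^sub>0\<close>. Hence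
  \<open>\<lambda>(\<eta>) = q\<^sub>0 (1 + 2r)\<close>, which is positive and continuous on \<open>(0, 1)\<close> and tends to \<open>0\<close> exactly at
  both end points, and the intermediate value theorem applies on both sides of \<open>1/2\<close>.

  Uniqueness of \<open>\<mu>\<close> follows from applying the length argument to the absolute value of the
  difference of two solutions, existence from an explicit geometric mixture of laws on queues of
  fixed length.
\<close>

section \<open>Unconditional sums and the masses of a pmf\<close>

lemma has_sum_pmf: "(pmf p has_sum measure (measure_pmf p) A) A"
proof -
  have *: "Infinite_Set_Sum.abs_summable_on (pmf p) A"
    by (rule pmf_abs_summable)
  hence "(\<lambda>x. norm (pmf p x)) summable_on A"
    by (rule iffD2[OF abs_summable_equivalent])
  hence "pmf p summable_on A"
    by (rule abs_summable_summable)
  moreover have "infsum (pmf p) A = measure (measure_pmf p) A"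
    by (rule infsetsum_infsum[OF *, folded measure_pmf_conv_infsetsum, symmetric])
  ultimately show ?thesis
    using has_sum_infsum[of "pmf p" A] by simp
qed

lemma summable_pmf: "pmf p summable_on A"
  using has_sum_pmf summable_on_def by blast

lemma infsum_pmf: "infsum (pmf p) A = measure (measure_pmf p) A"
  using has_sum_pmf infsumI by blast

lemma summable_on_real_subset: "f summable_on UNIV \<Longrightarrow> f summable_on A" for f :: "'a \<Rightarrow> real"
  by (rule summable_on_subset_banach) auto

lemma has_sum_infsum_subset: "f summable_on UNIV \<Longrightarrow> (f has_sum infsum f A) A" for f :: "'a \<Rightarrow> real"
  by (rule has_sum_infsum[OF summable_on_real_subset])

lemma has_sum_times:
  fixes f :: "'a \<Rightarrow> real" and x :: "'b \<Rightarrow> real"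
  assumes f: "f summable_on A" and x: "x summable_on B"
  shows "((\<lambda>(a, b). f a * x b) has_sum (infsum f A * infsum x B)) (A \<times> B)"
proof (rule has_sum_SigmaI)
  show "((\<lambda>y. case (a, y) of (a, b) \<Rightarrow> f a * x b) has_sum f a * infsum x B) B" for a
    using has_sum_cmult_right[OF has_sum_infsum[OF x], of "f a"] by simp
  show "((\<lambda>a. f a * infsum x B) has_sum (infsum f A * infsum x B)) A"
    by (rule has_sum_cmult_left[OF has_sum_infsum[OF f]])
  have af: "(\<lambda>a. \<bar>f a\<bar>) summable_on A"
    using f summable_on_iff_abs_summable_on_real[of f A] by (simp only: real_norm_def)
  have ax: "(\<lambda>b. \<bar>x b\<bar>) summable_on B"
    using x summable_on_iff_abs_summable_on_real[of x B] by (simp only: real_norm_def)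
  have "(\<lambda>p. norm (f (fst p) * x (snd p))) summable_on (A \<times> B)"
  proof (rule summable_on_SigmaI)
    show "((\<lambda>y. norm (f (fst (a, y)) * x (snd (a, y)))) has_sum \<bar>f a\<bar> * (\<Sum>\<^sub>\<infinity>b\<in>B. \<bar>x b\<bar>)) B" for a
      using ax by (auto simp: abs_mult intro!: has_sum_cmult_right)
    show "(\<lambda>a. \<bar>f a\<bar> * (\<Sum>\<^sub>\<infinity>b\<in>B. \<bar>x b\<bar>)) summable_on A"
      by (rule summable_on_cmult_left[OF af])
  qed auto
  thus "(\<lambda>(a, b). f a * x b) summable_on A \<times> B"
    unfolding case_prod_unfold by (rule abs_summable_summable)
qed

lemma has_sum_minus:
  fixes f g :: "'a \<Rightarrow> real"
  shows "(f has_sum a) A \<Longrightarrow> (g has_sum b) A \<Longrightarrow> ((\<lambda>x. f x - g x) has_sum (a - b)) A"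
  using has_sum_add[of f A a "\<lambda>x. - g x" "- b"] by (simp add: has_sum_uminus)

section \<open>Pairing the flow with events on a single queue position\<close>

text \<open>The left-hand side of the system as a linear function of \<open>f\<close>, with the rates
  \<open>x k = \<nu>\<^sub>k + \<lambda>\<delta>(k, 0)\<close> decoupled from \<open>f\<close>.\<close>

definition flow :: "real \<Rightarrow> (int \<Rightarrow> real) \<Rightarrow> (int list \<Rightarrow> real) \<Rightarrow> int list \<Rightarrow> real" where
  "flow \<beta> x f ns =
     (if ns = [] then 0 else f (butlast ns) * x (last ns))
     - f ns * infsum x UNIV + (\<Sum>\<^sub>\<infinity>k. f (k # ns)) - f ns * of_bool (ns \<noteq> [])
     + \<beta> * (f (map (\<lambda>n. n + 1) ns) + f (map (\<lambda>n. n - 1) ns) - 2 * f ns)"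

text \<open>Positions count from 0 at the head. For \<open>K = UNIV\<close> this is the event that
  the length exceeds \<open>j\<close>, so length tails and single marks obey the same
  identities.\<close>

definition at_pos :: "nat \<Rightarrow> int set \<Rightarrow> int list set" where
  "at_pos j K = {ns. j < length ns \<and> ns ! j \<in> K}"

text \<open>Every list in \<open>at_pos j K\<close> arises uniquely by appending some
  \<open>a\<close> to some \<open>ns\<close>: either \<open>ns\<close> already lies in
  \<open>at_pos j K\<close> and \<open>a\<close> is arbitrary, or \<open>ns\<close> has length
  \<open>j\<close> and \<open>a\<close> lies in \<open>K\<close>.\<close>

lemma has_sum_arrivals:
  fixes f :: "int list \<Rightarrow> real" and x :: "int \<Rightarrow> real"
  assumes f: "f summable_on UNIV" and x: "x summable_on UNIV"
  shows "((\<lambda>ns. f (butlast ns) * x (last ns)) has_sum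
           (infsum f (at_pos j K) * infsum x UNIV + infsum f {ns. length ns = j} * infsum x K))
         (at_pos j K)"
proof -
  let ?h = "\<lambda>(ns, a). ns @ [a]" and ?g = "\<lambda>(ns, a). f ns * x a"
  let ?B = "at_pos j K \<times> UNIV" and ?C = "{ns. length ns = j} \<times> K"
  note sf = summable_on_real_subset[OF f] and sx = summable_on_real_subset[OF x]
  have inj: "inj_on ?h (?B \<union> ?C)"
    by (auto simp: inj_on_def)
  have im: "at_pos j K = ?h ` (?B \<union> ?C)"
  proof (intro equalityI subsetI)
    fix ns assume ns: "ns \<in> at_pos j K"
    hence "ns \<noteq> []" by (auto simp: at_pos_def)
    then obtain ms a where *: "ns = ms @ [a]" by (metis rev_exhaust)
    hence "(ms, a) \<in> ?B \<union> ?C"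
      using ns by (auto simp: at_pos_def nth_append less_Suc_eq split: if_splits)
    thus "ns \<in> ?h ` (?B \<union> ?C)" using * by force
  qed (auto simp: at_pos_def nth_append)
  have "(?g has_sum (infsum f (at_pos j K) * infsum x UNIV + infsum f {ns. length ns = j} * infsum x K)) (?B \<union> ?C)"
    by (intro has_sum_Un_disjoint has_sum_times sf sx) (auto simp: at_pos_def)
  moreover have "?g = (\<lambda>ns. f (butlast ns) * x (last ns)) \<circ> ?h"
    by (auto simp: fun_eq_iff)
  ultimately show ?thesis
    by (subst im) (simp add: has_sum_reindex[OF inj])
qed

text \<open>Prepending \<open>k\<close> moves position \<open>j\<close> to \<open>j + 1\<close>, so
  the double sum over \<open>ns\<close> and \<open>k\<close> is a reindexed sum over
  \<open>at_pos (Suc j) K\<close>.\<close>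

lemma has_sum_departures:
  fixes f :: "int list \<Rightarrow> real"
  assumes f: "f summable_on UNIV"
  shows "((\<lambda>ns. \<Sum>\<^sub>\<infinity>k. f (k # ns)) has_sum infsum f (at_pos (Suc j) K)) (at_pos j K)"
proof -
  let ?h = "\<lambda>(ns, k). k # ns"
  have inj: "inj_on ?h (at_pos j K \<times> UNIV)" by (auto simp: inj_on_def)
  have im: "at_pos (Suc j) K = ?h ` (at_pos j K \<times> UNIV)"
  proof (intro equalityI subsetI)
    fix ns assume ns: "ns \<in> at_pos (Suc j) K"
    then obtain k ms where "ns = k # ms" by (cases ns) (auto simp: at_pos_def)
    thus "ns \<in> ?h ` (at_pos j K \<times> UNIV)"
      using ns by (auto simp: at_pos_def image_iff)
  qed (auto simp: at_pos_def)
  have "(f has_sum infsum f (at_pos (Suc j) K)) (at_pos (Suc j) K)"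
    by (rule has_sum_infsum_subset[OF f])
  hence 1: "(f \<circ> ?h has_sum infsum f (at_pos (Suc j) K)) (at_pos j K \<times> UNIV)"
    unfolding has_sum_reindex[OF inj, symmetric] im .
  have 2: "((\<lambda>k. (f \<circ> ?h) (ns, k)) has_sum (\<Sum>\<^sub>\<infinity>k. f (k # ns))) UNIV" for ns
  proof -
    have "f summable_on range (\<lambda>k. k # ns)"
      by (rule summable_on_real_subset[OF f])
    hence "(\<lambda>k. f (k # ns)) summable_on UNIV"
      by (subst (asm) summable_on_reindex) (auto simp: inj_on_def o_def)
    thus ?thesis by simp
  qed
  show ?thesis by (rule has_sum_SigmaD[OF 1 2])
qed

lemma has_sum_shift:
  fixes f :: "int list \<Rightarrow> real"
  assumes f: "f summable_on UNIV"
  shows "((\<lambda>ns. f (map (\<lambda>n. n + c) ns)) has_sum infsum f (at_pos j ((\<lambda>k. k + c) ` K))) (at_pos j K)"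
proof -
  let ?h = "map (\<lambda>n. n + c)"
  have inj: "inj_on ?h (at_pos j K)" by (auto simp: inj_on_def)
  have im: "at_pos j ((\<lambda>k. k + c) ` K) = ?h ` at_pos j K"
  proof (intro equalityI subsetI)
    fix ns assume ns: "ns \<in> at_pos j ((\<lambda>k. k + c) ` K)"
    have "ns = ?h (map (\<lambda>n. n - c) ns)" by (simp add: o_def)
    moreover have "map (\<lambda>n. n - c) ns \<in> at_pos j K"
      using ns by (auto simp: at_pos_def)
    ultimately show "ns \<in> ?h ` at_pos j K" by blast
  qed (auto simp: at_pos_def)
  have "(f has_sum infsum f (at_pos j ((\<lambda>k. k + c) ` K))) (at_pos j ((\<lambda>k. k + c) ` K))"
    by (rule has_sum_infsum_subset[OF f])
  thus ?thesis
    unfolding im has_sum_reindex[OF inj] o_def .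
qed

text \<open>Pairing the flow with the indicator of the event that the customer in position \<open>j\<close> has a mark
  in \<open>K\<close>: an arrival creates the event only from queues of length \<open>j\<close>, a departure moves
  position \<open>j + 1\<close> to position \<open>j\<close>.\<close>

lemma has_sum_flow_at_pos:
  fixes f :: "int list \<Rightarrow> real"
  assumes f: "f summable_on UNIV" and x: "x summable_on UNIV"
  defines "V \<equiv> \<lambda>j K. infsum f (at_pos j K)"
  shows "(flow \<beta> x f has_sum
           (infsum f {ns. length ns = j} * infsum x K + V (Suc j) K - V j K
            + \<beta> * (V j ((\<lambda>k. k + 1) ` K) + V j ((\<lambda>k. k - 1) ` K) - 2 * V j K))) (at_pos j K)"
proof -
  have fV: "(f has_sum V j K) (at_pos j K)"
    unfolding V_def by (rule has_sum_infsum_subset[OF f])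
  have "((\<lambda>ns. f (butlast ns) * x (last ns) - f ns * infsum x UNIV + (\<Sum>\<^sub>\<infinity>k. f (k # ns)) - f ns
          + \<beta> * (f (map (\<lambda>n. n + 1) ns) + f (map (\<lambda>n. n + - 1) ns) - 2 * f ns)) has_sum
         ((V j K * infsum x UNIV + infsum f {ns. length ns = j} * infsum x K) - V j K * infsum x UNIV
          + V (Suc j) K - V j K
          + \<beta> * (V j ((\<lambda>k. k + 1) ` K) + V j ((\<lambda>k. k + - 1) ` K) - 2 * V j K))) (at_pos j K)"
    unfolding V_def
    by (intro has_sum_minus has_sum_add has_sum_cmult_right has_sum_cmult_left
        fV[unfolded V_def] has_sum_arrivals[OF f x] has_sum_departures[OF f] has_sum_shift[OF f])
  moreover have "flow \<beta> x f ns = f (butlast ns) * x (last ns) - f ns * infsum x UNIV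
      + (\<Sum>\<^sub>\<infinity>k. f (k # ns)) - f ns
      + \<beta> * (f (map (\<lambda>n. n + 1) ns) + f (map (\<lambda>n. n + - 1) ns) - 2 * f ns)" if "ns \<in> at_pos j K" for ns
    using that by (auto simp: flow_def at_pos_def)
  ultimately have "(flow \<beta> x f has_sum
         ((V j K * infsum x UNIV + infsum f {ns. length ns = j} * infsum x K) - V j K * infsum x UNIV
          + V (Suc j) K - V j K
          + \<beta> * (V j ((\<lambda>k. k + 1) ` K) + V j ((\<lambda>k. k + - 1) ` K) - 2 * V j K))) (at_pos j K)"
    by (subst has_sum_cong)
  thus ?thesis by simp
qed

text \<open>Maximum principle: the recursion forces the supremum norms of \<open>W j\<close> to be nondecreasing
  in \<open>j\<close>.\<close>

lemma laplace_decay: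
  fixes W :: "nat \<Rightarrow> int \<Rightarrow> real"
  assumes \<beta>: "\<beta> \<ge> 0"
    and W: "\<And>j k. W (Suc j) k = W j k - \<beta> * (W j (k + 1) + W j (k - 1) - 2 * W j k)"
    and B: "\<And>j k. \<bar>W j k\<bar> \<le> B j" and lim: "B \<longlonglongrightarrow> 0"
  shows "W j k = 0"
proof -
  define N where "N j = (SUP k. \<bar>W j k\<bar>)" for j
  have bdd: "bdd_above (range (\<lambda>k. \<bar>W j k\<bar>))" for j
    by (rule bdd_aboveI2[of _ _ "B j"]) (use B in auto)
  have le: "\<bar>W j k\<bar> \<le> N j" for j k
    unfolding N_def by (rule cSUP_upper[OF UNIV_I bdd])
  have NB: "N j \<le> B j" for j
    unfolding N_def by (rule cSUP_least) (use B in auto)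
  have step: "N j \<le> N (Suc j)" for j
  proof -
    \<comment> \<open>Solved for its diagonal term, the recursion gives \<open>W j k\<close> the
      coefficient \<open>1 + 2 * \<beta>\<close>; the neighbours contribute at most
      \<open>2 * \<beta> * N j\<close>, which is absorbed and leaves
      \<open>N j \<le> N (Suc j)\<close>.\<close>
    have "\<bar>W j k\<bar> \<le> (N (Suc j) + 2 * \<beta> * N j) / (1 + 2 * \<beta>)" for k
    proof -
      have "(1 + 2 * \<beta>) * \<bar>W j k\<bar> = \<bar>(1 + 2 * \<beta>) * W j k\<bar>"
        using \<beta> by (simp add: abs_mult)
      also have "(1 + 2 * \<beta>) * W j k = W (Suc j) k + \<beta> * (W j (k + 1) + W j (k - 1))"
        using W[of j k] by (simp add: algebra_simps)
      also have "\<bar>\<dots>\<bar> \<le> \<bar>W (Suc j) k\<bar> + \<beta> * \<bar>W j (k + 1) + W j (k - 1)\<bar>"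
        using \<beta> abs_triangle_ineq[of "W (Suc j) k" "\<beta> * (W j (k + 1) + W j (k - 1))"]
        by (simp add: abs_mult)
      also have "\<dots> \<le> \<bar>W (Suc j) k\<bar> + \<beta> * (\<bar>W j (k + 1)\<bar> + \<bar>W j (k - 1)\<bar>)"
        using \<beta> by (intro add_left_mono mult_left_mono abs_triangle_ineq)
      also have "\<dots> \<le> N (Suc j) + \<beta> * (N j + N j)"
        using \<beta> by (intro add_mono mult_left_mono le)
      finally show ?thesis
        using \<beta> by (simp add: field_simps)
    qed
    hence "N j \<le> (N (Suc j) + 2 * \<beta> * N j) / (1 + 2 * \<beta>)"
      unfolding N_def[of j] by (intro cSUP_least) auto
    thus ?thesis using \<beta> by (simp add: field_simps)
  qed
  have "N j \<le> B i" if "j \<le> i" for i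
    using lift_Suc_mono_le[of N, OF step that] NB[of i] by linarith
  hence "N j \<le> 0"
    by (intro LIMSEQ_le_const[OF lim]) auto
  with le[of j k] show ?thesis by simp
qed

section \<open>Queue length and law of the first mark for fixed rates\<close>

lemma at_pos_UNIV_split:
  "at_pos j UNIV = {ns. length ns = Suc j} \<union> at_pos (Suc j) UNIV"
  "{ns. length ns = Suc j} \<inter> at_pos (Suc j) UNIV = {}"
  by (auto simp: at_pos_def)

lemma shift_UNIV: "range (\<lambda>k. k + 1) = (UNIV :: int set)" "range (\<lambda>k. k - 1) = (UNIV :: int set)"
  by (rule surjI[of _ "\<lambda>k. k - 1"], simp) (rule surjI[of _ "\<lambda>k. k + 1"], simp)

text \<open>For \<open>K = UNIV\<close> the shifted events coincide with the original one, so the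
  diffusion cancels, and two consecutive length tails differ by one length mass. A general summable
  \<open>f\<close> is allowed because uniqueness applies this to an absolute difference of two
  laws.\<close>

lemma flow_tail:
  fixes f :: "int list \<Rightarrow> real"
  assumes f: "f summable_on UNIV" and x: "x summable_on UNIV"
  shows "infsum (flow \<beta> x f) (at_pos j UNIV)
     = infsum f {ns. length ns = j} * infsum x UNIV - infsum f {ns. length ns = Suc j}"
proof -
  have "infsum f (at_pos j UNIV) = infsum f {ns. length ns = Suc j} + infsum f (at_pos (Suc j) UNIV)"
    using infsum_Un_disjoint[OF summable_on_real_subset[OF f] summable_on_real_subset[OF f] at_pos_UNIV_split(2)[of j]]
    by (simp only: at_pos_UNIV_split(1)[of j])
  moreover have "infsum (flow \<beta> x f) (at_pos j UNIV)
     = infsum f {ns. length ns = j} * infsum x UNIV + infsum f (at_pos (Suc j) UNIV) - infsum f (at_pos j UNIV)"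
    using infsumI[OF has_sum_flow_at_pos[OF f x, of \<beta> j UNIV]] by (simp add: shift_UNIV)
  ultimately show ?thesis by simp
qed

text \<open>The rates \<open>x\<close> are not tied to \<open>nu p\<close>: the linear results then
  cover both solutions of the nonlinear system and laws constructed from prescribed rates.\<close>

locale stationary =
  fixes \<beta> \<eta> :: real and x :: "int \<Rightarrow> real" and p :: "int list pmf"
  assumes \<beta>: "\<beta> > 0" and \<eta>: "0 < \<eta>" "\<eta> < 1"
    and x: "(x has_sum \<eta>) UNIV" and flow: "\<And>ns. flow \<beta> x (pmf p) ns = 0"
begin

lemma summable_x: "x summable_on UNIV" and infsum_x: "infsum x UNIV = \<eta>"
  using has_sum_imp_summable[OF x] infsumI[OF x] by simp_all

lemma flow_eq_0: "flow \<beta> x (pmf p) = (\<lambda>_. 0)"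
  using flow by (simp add: fun_eq_iff)

text \<open>Vanishing flow makes consecutive length masses have ratio \<open>\<eta>\<close>; total
  mass 1 then fixes the first one.\<close>

lemma prob_length: "measure p {ns. length ns = j} = (1 - \<eta>) * \<eta> ^ j"
proof -
  let ?S = "\<lambda>j. measure p {ns. length ns = j}"
  have S: "?S (Suc j) = \<eta> * ?S j" for j
    using flow_tail[OF summable_pmf summable_x, of \<beta> p j]
    by (simp add: flow_eq_0 infsum_pmf infsum_x mult.commute)
  have S0: "?S j = ?S 0 * \<eta> ^ j" for j
    by (induction j) (simp_all add: S)
  have "(\<lambda>j. ?S j) sums measure p (\<Union>j. {ns. length ns = j})"
    by (rule measure_pmf.finite_measure_UNION) (auto simp: disjoint_family_on_def)
  also have "(\<Union>j. {ns :: int list. length ns = j}) = UNIV" by auto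
  finally have "(\<lambda>j. ?S 0 * \<eta> ^ j) sums 1"
    unfolding S0[symmetric] by simp
  moreover have "(\<lambda>j. ?S 0 * \<eta> ^ j) sums (?S 0 * (1 / (1 - \<eta>)))"
    using \<eta> by (intro sums_mult geometric_sums) auto
  ultimately have "1 = ?S 0 * (1 / (1 - \<eta>))"
    by (rule sums_unique2)
  hence "?S 0 = 1 - \<eta>"
    using \<eta> by (simp add: field_simps)
  with S0[of j] show ?thesis by simp
qed

lemma prob_length_gt: "measure p (at_pos j UNIV) = \<eta> ^ Suc j"
proof (induction j)
  case 0
  have "at_pos 0 UNIV = - {ns. length ns = 0}" by (auto simp: at_pos_def)
  thus ?case
    using measure_pmf.prob_compl[of "{ns. length ns = 0}" p] prob_length[of 0]
    by (simp add: Compl_eq_Diff_UNIV)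
next
  case (Suc j)
  have "measure p (at_pos j UNIV) = measure p {ns. length ns = Suc j} + measure p (at_pos (Suc j) UNIV)"
    by (subst at_pos_UNIV_split(1), rule measure_pmf.finite_measure_Union) (simp_all add: at_pos_UNIV_split(2))
  thus ?case using Suc prob_length[of "Suc j"] by (simp add: algebra_simps)
qed

text \<open>If \<open>V j k\<close> is the probability that position \<open>j\<close> carries the mark \<open>k\<close>, then the defects
  \<open>V (j + 1) - \<eta> V j\<close> satisfy the homogeneous recursion of \<open>laplace_decay\<close>, so they vanish.\<close>

lemma head_law:
  defines "q \<equiv> \<lambda>k. measure p (at_pos 0 {k})"
  shows "(1 - \<eta>) * (q k - x k) = \<beta> * (q (k + 1) + q (k - 1) - 2 * q k)"
proof -
  define V where "V j k = measure p (at_pos j {k})" for j k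
  \<comment> \<open>The source term \<open>(1 - \<eta>) * \<eta> ^ j * x k\<close> in the recursion
    for \<open>V\<close> is geometric in \<open>j\<close> with ratio \<open>\<eta>\<close>, so it
    cancels in this combination.\<close>
  define W where "W j k = V (Suc j) k - \<eta> * V j k" for j k
  have V: "V (Suc j) k = V j k - (1 - \<eta>) * \<eta> ^ j * x k - \<beta> * (V j (k + 1) + V j (k - 1) - 2 * V j k)" for j k
    using infsumI[OF has_sum_flow_at_pos[OF summable_pmf summable_x, of \<beta> p j "{k}"]]
    by (simp add: flow_eq_0 infsum_pmf prob_length V_def)
  have V_le: "\<bar>V j k\<bar> \<le> \<eta> ^ Suc j" for j k
  proof -
    have "V j k \<le> measure p (at_pos j UNIV)"
      unfolding V_def by (intro measure_pmf.finite_measure_mono) (auto simp: at_pos_def)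
    thus ?thesis by (simp add: prob_length_gt V_def)
  qed
  have "W 0 k = 0"
  proof (rule laplace_decay[where \<beta> = \<beta> and B = "\<lambda>j. \<eta> ^ Suc (Suc j) + \<eta> * \<eta> ^ Suc j"])
    show "W (Suc j) k = W j k - \<beta> * (W j (k + 1) + W j (k - 1) - 2 * W j k)" for j k
      unfolding W_def V[of "Suc j" k] using arg_cong[OF V[of j k], of "\<lambda>z. \<eta> * z"]
      by (simp add: algebra_simps)
    show "\<bar>W j k\<bar> \<le> \<eta> ^ Suc (Suc j) + \<eta> * \<eta> ^ Suc j" for j k
    proof -
      have "\<bar>W j k\<bar> \<le> \<bar>V (Suc j) k\<bar> + \<eta> * \<bar>V j k\<bar>"
        unfolding W_def using \<eta> abs_triangle_ineq4[of "V (Suc j) k" "\<eta> * V j k"] by (simp add: abs_mult)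
      also have "\<dots> \<le> \<eta> ^ Suc (Suc j) + \<eta> * \<eta> ^ Suc j"
        using \<eta> by (intro add_mono mult_left_mono V_le) auto
      finally show ?thesis .
    qed
    have "(\<lambda>j. 2 * \<eta>\<^sup>2 * \<eta> ^ j) \<longlonglongrightarrow> 2 * \<eta>\<^sup>2 * 0"
      using \<eta> by (intro tendsto_intros LIMSEQ_realpow_zero) auto
    thus "(\<lambda>j. \<eta> ^ Suc (Suc j) + \<eta> * \<eta> ^ Suc j) \<longlonglongrightarrow> 0"
      by (simp add: power2_eq_square mult.assoc)
  qed (use \<beta> in auto)
  thus ?thesis
    using V[of 0 k] by (simp add: W_def V_def q_def algebra_simps)
qed

end

section \<open>Uniqueness of the law for given nonnegative rates\<close>

lemma flow_diff:
  assumes "f summable_on UNIV" "g summable_on UNIV"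
  shows "flow \<beta> x (\<lambda>ns. f ns - g ns) ns = flow \<beta> x f ns - flow \<beta> x g ns"
proof -
  have *: "(\<lambda>k. h (k # ns)) summable_on UNIV" if "h summable_on UNIV" for h :: "int list \<Rightarrow> real"
  proof -
    have "h summable_on range (\<lambda>k. k # ns)"
      by (rule summable_on_real_subset[OF that])
    thus ?thesis
      by (subst (asm) summable_on_reindex) (auto simp: inj_on_def o_def)
  qed
  have "(\<Sum>\<^sub>\<infinity>k. f (k # ns) - g (k # ns)) = (\<Sum>\<^sub>\<infinity>k. f (k # ns)) - (\<Sum>\<^sub>\<infinity>k. g (k # ns))"
    by (intro infsumI has_sum_minus has_sum_infsum * assms)
  thus ?thesis by (cases ns) (simp_all add: flow_def algebra_simps)
qed

text \<open>The loss terms are all multiples of \<open>f ns\<close>. With them alone on one side of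
  the equation, the triangle inequality bounds the loss of \<open>\<bar>f\<bar>\<close> by its
  gain.\<close>

lemma flow_abs_nonneg:
  assumes f: "f summable_on UNIV" and \<beta>: "\<beta> \<ge> 0" and x: "\<And>k. x k \<ge> 0"
    and flow: "flow \<beta> x f ns = 0"
  shows "flow \<beta> x (\<lambda>ns. \<bar>f ns\<bar>) ns \<ge> 0"
proof -
  let ?a = "if ns = [] then 0 else f (butlast ns) * x (last ns)"
  let ?b = "\<Sum>\<^sub>\<infinity>k. f (k # ns)" and ?c = "infsum x UNIV + of_bool (ns \<noteq> []) + 2 * \<beta>"
  let ?u = "f (map (\<lambda>n. n + 1) ns)" and ?v = "f (map (\<lambda>n. n - 1) ns)"
  have c: "?c \<ge> 0" using \<beta> x by (simp add: infsum_nonneg)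
  have "(\<lambda>ns. \<bar>f ns\<bar>) summable_on UNIV"
    using f summable_on_iff_abs_summable_on_real[of f UNIV] by (simp only: real_norm_def)
  hence "(\<lambda>ns. \<bar>f ns\<bar>) summable_on range (\<lambda>k. k # ns)"
    by (rule summable_on_real_subset)
  hence "(\<lambda>k. \<bar>f (k # ns)\<bar>) summable_on UNIV"
    by (subst (asm) summable_on_reindex) (auto simp: inj_on_def o_def)
  hence b: "\<bar>?b\<bar> \<le> (\<Sum>\<^sub>\<infinity>k. \<bar>f (k # ns)\<bar>)"
    using norm_infsum_bound[of "\<lambda>k. f (k # ns)" UNIV] by simp
  have "?c * f ns = ?a + ?b + \<beta> * ?u + \<beta> * ?v"
    using flow by (simp add: flow_def algebra_simps)
  hence "?c * \<bar>f ns\<bar> = \<bar>?a + ?b + \<beta> * ?u + \<beta> * ?v\<bar>"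
    using c by (metis abs_mult abs_of_nonneg)
  also have "\<dots> \<le> \<bar>?a\<bar> + \<bar>?b\<bar> + \<beta> * \<bar>?u\<bar> + \<beta> * \<bar>?v\<bar>"
    using \<beta> abs_mult[of \<beta> ?u] abs_mult[of \<beta> ?v] by linarith
  finally show ?thesis
    using b x by (simp add: flow_def abs_mult algebra_simps split: if_splits)
qed

text \<open>The absolute difference \<open>m\<close> has nonnegative flow, so its mass on length
  \<open>j + 1\<close> is at most \<open>\<eta>\<close> times that on length \<open>j\<close>. Both
  laws give the empty queue probability \<open>1 - \<eta>\<close>, so these masses start at 0 and
  stay there.\<close>

lemma stationary_unique:
  assumes p: "stationary \<beta> \<eta> x p" and p': "stationary \<beta> \<eta> x p'" and x: "\<And>k. x k \<ge> 0"
  shows "p = p'"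
proof -
  interpret p: stationary \<beta> \<eta> x p by fact
  interpret p': stationary \<beta> \<eta> x p' by fact
  define d where "d ns = pmf p ns - pmf p' ns" for ns
  define m where "m ns = \<bar>d ns\<bar>" for ns
  let ?S = "\<lambda>j. infsum m {ns. length ns = j}"
  have d: "d summable_on UNIV"
    unfolding d_def by (rule has_sum_imp_summable[OF has_sum_minus[OF has_sum_pmf has_sum_pmf]])
  hence m: "m summable_on UNIV"
    using summable_on_iff_abs_summable_on_real[of d UNIV] unfolding m_def by (simp only: real_norm_def)
  have "flow \<beta> x d ns = 0" for ns
    unfolding d_def by (simp add: flow_diff summable_pmf p.flow p'.flow)
  hence flow: "flow \<beta> x m ns \<ge> 0" for ns
    unfolding m_def using p.\<beta> by (intro flow_abs_nonneg d x) auto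
  have "infsum (flow \<beta> x m) (at_pos j UNIV) \<ge> 0" for j
    by (intro infsum_nonneg flow)
  hence S: "?S (Suc j) \<le> \<eta> * ?S j" for j
    by (simp add: flow_tail[OF m p.summable_x] p.infsum_x mult.commute)
  have nil: "{ns :: int list. length ns = 0} = {[]}" by auto
  have "?S 0 = 0"
    using p.prob_length[of 0] p'.prob_length[of 0] unfolding nil
    by (simp add: m_def d_def pmf.rep_eq)
  have S0: "?S j \<le> 0" for j
  proof (induction j)
    case (Suc j)
    have "\<eta> * ?S j \<le> 0" using Suc p.\<eta> by (simp add: mult_le_0_iff)
    with S[of j] show ?case by linarith
  qed (use \<open>?S 0 = 0\<close> in simp)
  have "m ns = 0" for ns
  proof -
    have "infsum m {ns} \<le> ?S (length ns)"
      by (intro infsum_mono2 summable_on_real_subset[OF m]) (auto simp: m_def)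
    thus ?thesis using S0[of "length ns"] by (simp add: m_def)
  qed
  thus ?thesis by (intro pmf_eqI) (simp add: m_def d_def)
qed

section \<open>Head probabilities, the rates \<open>nu\<close> and the inflow\<close>

definition head_prob :: "int list pmf \<Rightarrow> int \<Rightarrow> real" where
  "head_prob p k = measure p (at_pos 0 {k})"

lemma infsum_pmf_Cons: "(\<Sum>\<^sub>\<infinity>ns. pmf p (k # ns)) = head_prob p k"
proof -
  have "(\<Sum>\<^sub>\<infinity>ns. pmf p (k # ns)) = infsum (pmf p) (range ((#) k))"
    by (subst infsum_reindex) (simp_all add: o_def)
  also have "range ((#) k) = at_pos 0 {k}"
  proof (intro equalityI subsetI)
    fix ns assume "ns \<in> at_pos 0 {k}"
    thus "ns \<in> range ((#) k)" by (cases ns) (auto simp: at_pos_def)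
  qed (auto simp: at_pos_def)
  finally show ?thesis by (simp add: infsum_pmf head_prob_def)
qed

lemma nu_eq: "nu p k = (if k > 0 then head_prob p (k + 1) else if k < 0 then head_prob p (k - 1) else 0)"
  by (simp add: nu_def infsum_pmf_Cons)

lemma head_prob_nonneg: "head_prob p k \<ge> 0"
  by (simp add: head_prob_def)

lemma head_prob_le_1: "head_prob p k \<le> 1"
  by (simp add: head_prob_def)

lemma has_sum_head_prob: "(head_prob p has_sum measure p (at_pos 0 UNIV)) UNIV"
proof -
  \<comment> \<open>The empty queue has no first mark; sending it to \<open>None\<close> keeps it
    out of the preimage of every \<open>Some k\<close>.\<close>
  define h where "h ns = (if ns = [] then None else Some (hd ns))" for ns :: "int list"
  have "h -` range Some = at_pos 0 UNIV"
    by (auto simp: h_def at_pos_def)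
  hence "(pmf (map_pmf h p) has_sum measure p (at_pos 0 UNIV)) (range Some)"
    using has_sum_pmf[of "map_pmf h p" "range Some"] by (simp add: measure_map_pmf)
  hence "((\<lambda>k. pmf (map_pmf h p) (Some k)) has_sum measure p (at_pos 0 UNIV)) UNIV"
    by (simp add: has_sum_reindex o_def)
  moreover have "h -` {Some k} = at_pos 0 {k}" for k
    by (auto simp: h_def at_pos_def hd_conv_nth split: if_splits)
  ultimately show ?thesis
    by (simp add: pmf_map head_prob_def[abs_def])
qed

lemma summable_nu: "nu p summable_on A"
proof -
  have shift: "(\<lambda>k. head_prob p (k + c)) summable_on UNIV" for c
  proof -
    have "head_prob p summable_on range (\<lambda>k. k + c)"
      by (rule summable_on_real_subset[OF has_sum_imp_summable[OF has_sum_head_prob]])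
    thus ?thesis
      by (subst (asm) summable_on_reindex) (auto simp: inj_on_def o_def)
  qed
  have "(\<lambda>k. head_prob p (k + 1) + head_prob p (k + - 1)) summable_on UNIV"
    by (intro summable_on_add shift)
  hence "(\<lambda>k. norm (nu p k)) summable_on UNIV"
    by (rule Infinite_Sum.abs_summable_on_comparison_test') (auto simp: nu_eq head_prob_nonneg)
  hence "nu p summable_on UNIV"
    by (rule abs_summable_summable)
  thus ?thesis by (rule summable_on_real_subset)
qed

text \<open>Since \<open>nu\<close> vanishes at 0, putting \<open>lam\<close> there makes the inflow
  the total mass of one rate function.\<close>

lemma has_sum_inflow: "((\<lambda>k. nu p k + lam * of_bool (k = 0)) has_sum inflow lam p) UNIV"
proof -
  have "((\<lambda>k. nu p k + lam * of_bool (k = 0)) has_sum infsum (nu p) {k. k \<noteq> 0}) {k. k \<noteq> 0}"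
    using has_sum_infsum[OF summable_nu] by (subst has_sum_cong[where g = "nu p"]) auto
  moreover have "((\<lambda>k. nu p k + lam * of_bool (k = 0)) has_sum lam) {0}"
    using has_sum_finite[of "{0 :: int}" "\<lambda>k. nu p k + lam * of_bool (k = 0)"] by (simp add: nu_def)
  ultimately have "((\<lambda>k. nu p k + lam * of_bool (k = 0)) has_sum (infsum (nu p) {k. k \<noteq> 0} + lam))
      ({k. k \<noteq> 0} \<union> {0})"
    by (rule has_sum_Un_disjoint) auto
  also have "{k :: int. k \<noteq> 0} \<union> {0} = UNIV" by auto
  finally show ?thesis by (simp add: inflow_def)
qed

text \<open>This absorbs the nonlinearity into the parameter \<open>x\<close>, so that the linear
  results apply to the system.\<close>

lemma balance_eq_flow:
  "balance \<beta> lam p ns = flow \<beta> (\<lambda>k. nu p k + lam * of_bool (k = 0)) (pmf p) ns"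
  using infsumI[OF has_sum_inflow[of p lam]] by (simp add: balance_def flow_def)

section \<open>Geometric head law and closed formulas for the rates\<close>

lemma has_sum_two_sided_geometric:
  fixes r :: real
  assumes "0 \<le> r" "r < 1"
  shows "((\<lambda>k::int. r ^ nat \<bar>k\<bar>) has_sum ((1 + r) / (1 - r))) UNIV"
proof -
  have g: "((\<lambda>n. r ^ n) has_sum (1 / (1 - r))) UNIV"
    using assms by (intro sums_nonneg_imp_has_sum geometric_sums) auto
  have 1: "((\<lambda>k::int. r ^ nat \<bar>k\<bar>) has_sum (1 / (1 - r))) (range int)"
    using g by (subst has_sum_reindex) (auto simp: inj_on_def o_def)
  have 2: "((\<lambda>k::int. r ^ nat \<bar>k\<bar>) has_sum (r * (1 / (1 - r)))) (range (\<lambda>n. - int (Suc n)))"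
    using has_sum_cmult_right[OF g, of r]
    by (subst has_sum_reindex) (auto simp: inj_on_def o_def nat_add_distrib)
  have "range int \<union> range (\<lambda>n. - int (Suc n)) = UNIV"
  proof (intro equalityI subsetI)
    fix k :: int show "k \<in> range int \<union> range (\<lambda>n. - int (Suc n))"
      by (cases k rule: int_cases) auto
  qed simp
  moreover have "((\<lambda>k::int. r ^ nat \<bar>k\<bar>) has_sum (1 / (1 - r) + r * (1 / (1 - r))))
      (range int \<union> range (\<lambda>n. - int (Suc n)))"
    by (intro has_sum_Un_disjoint 1 2) auto
  ultimately show ?thesis by (simp add: add_divide_distrib)
qed

text \<open>The characteristic roots are 1 and \<open>r\<close>. The quantity
  \<open>f (Suc n) - r * f n\<close> is conserved and tends to 0, which excludes the constant
  mode.\<close>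

lemma geometric_half_line:
  fixes f :: "nat \<Rightarrow> real"
  assumes "\<And>n. f (Suc n) - f (Suc (Suc n)) = r * (f n - f (Suc n))" and f: "f \<longlonglongrightarrow> 0"
  shows "f n = f 0 * r ^ n"
proof -
  define g where "g n = f (Suc n) - r * f n" for n
  have "g (Suc n) = g n" for n
    using assms(1)[of n] by (simp add: g_def algebra_simps)
  hence g: "g n = g 0" for n by (induction n) simp_all
  have "(\<lambda>n. f (Suc n) - r * f n) \<longlonglongrightarrow> 0 - r * 0"
    by (intro tendsto_intros f LIMSEQ_Suc)
  hence "g \<longlonglongrightarrow> 0" by (simp add: g_def[abs_def])
  hence "g 0 = 0" by (subst (asm) g[abs_def]) (simp add: LIMSEQ_const_iff)
  hence "f (Suc n) = r * f n" for n using g[of n] by (simp add: g_def)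
  thus ?thesis by (induction n) simp_all
qed

definition decay_rate :: "real \<Rightarrow> real \<Rightarrow> real" where
  "decay_rate \<beta> \<eta> = \<beta> / (\<beta> + 1 - \<eta>)"

text \<open>The value of the head law at mark 0, normalised so that the two-sided geometric law has
  mass \<open>\<eta>\<close>, the probability of a nonempty queue.\<close>

definition head0 :: "real \<Rightarrow> real \<Rightarrow> real" where
  "head0 \<beta> \<eta> = \<eta> * (1 - \<eta>) / (1 - \<eta> + 2 * \<beta>)"

definition lam_formula :: "real \<Rightarrow> real \<Rightarrow> real" where
  "lam_formula \<beta> \<eta> = head0 \<beta> \<eta> * (1 + 2 * decay_rate \<beta> \<eta>)"

definition arrival_rate :: "real \<Rightarrow> real \<Rightarrow> int \<Rightarrow> real" where
  "arrival_rate \<beta> \<eta> k =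
     (if k = 0 then lam_formula \<beta> \<eta> else head0 \<beta> \<eta> * decay_rate \<beta> \<eta> ^ Suc (nat \<bar>k\<bar>))"

lemma nat_one_minus: "k < 0 \<Longrightarrow> nat (1 - k) = Suc (nat (- k))"
  by simp

lemma nat_one_plus: "k > 0 \<Longrightarrow> nat (k + 1) = Suc (nat k)" "k > 0 \<Longrightarrow> nat (1 + k) = Suc (nat k)"
  by simp_all

context
  fixes \<beta> \<eta> :: real
  assumes \<beta>: "\<beta> > 0" and \<eta>: "0 < \<eta>" "\<eta> < 1"
begin

lemma decay_rate_bounds: "0 < decay_rate \<beta> \<eta>" "decay_rate \<beta> \<eta> < 1"
  using \<beta> \<eta> by (auto simp: decay_rate_def)

lemma head0_pos: "head0 \<beta> \<eta> > 0"
  using \<beta> \<eta> by (simp add: head0_def)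

lemma decay_rate_eq: "(1 - \<eta>) * decay_rate \<beta> \<eta> = \<beta> * (1 - decay_rate \<beta> \<eta>)"
proof -
  have "\<beta> + 1 - \<eta> \<noteq> 0" using \<beta> \<eta> by linarith
  thus ?thesis by (simp add: decay_rate_def field_simps)
qed

lemma head0_eq: "head0 \<beta> \<eta> * ((1 + decay_rate \<beta> \<eta>) / (1 - decay_rate \<beta> \<eta>)) = \<eta>"
proof -
  have nz: "\<beta> + 1 - \<eta> \<noteq> 0" "1 - \<eta> + 2 * \<beta> \<noteq> 0" "1 - \<eta> \<noteq> 0" using \<beta> \<eta> by linarith+
  have "1 + decay_rate \<beta> \<eta> = (1 - \<eta> + 2 * \<beta>) / (\<beta> + 1 - \<eta>)"
    and "1 - decay_rate \<beta> \<eta> = (1 - \<eta>) / (\<beta> + 1 - \<eta>)"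
    using nz by (simp_all add: decay_rate_def field_simps)
  thus ?thesis using nz by (simp add: head0_def)
qed

text \<open>Replacing \<open>x k\<close> by the outward neighbour turns the head equation into a
  recursion on each half-line. The head law is summable, hence tends to 0 and is geometric there,
  and its mass \<open>\<eta>\<close> fixes the value at 0.\<close>

lemma head_prob_explicit:
  assumes st: "stationary \<beta> \<eta> x p"
    and arrivals: "\<And>k. k > 0 \<Longrightarrow> x k = head_prob p (k + 1)" "\<And>k. k < 0 \<Longrightarrow> x k = head_prob p (k - 1)"
  shows "head_prob p k = head0 \<beta> \<eta> * decay_rate \<beta> \<eta> ^ nat \<bar>k\<bar>" and "x 0 = lam_formula \<beta> \<eta>"
proof -
  interpret stationary \<beta> \<eta> x p by fact
  let ?q = "head_prob p" and ?r = "decay_rate \<beta> \<eta>"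
  have law: "(1 - \<eta>) * (?q k - x k) = \<beta> * (?q (k + 1) + ?q (k - 1) - 2 * ?q k)" for k
    using head_law[of k] by (simp add: head_prob_def)
  have lim: "(\<lambda>n. ?q (s * int n)) \<longlonglongrightarrow> 0" if "s \<noteq> 0" for s
  proof -
    have "?q summable_on range (\<lambda>n. s * int n)"
      by (rule summable_on_real_subset[OF has_sum_imp_summable[OF has_sum_head_prob]])
    hence "(\<lambda>n. ?q (s * int n)) summable_on UNIV"
      using that by (subst (asm) summable_on_reindex) (auto simp: inj_on_def o_def)
    thus ?thesis by (rule summable_LIMSEQ_zero[OF summable_on_imp_summable])
  qed
  \<comment> \<open>Here \<open>a\<close> is the value at a nonzero mark, \<open>b\<close> the next
    value away from 0 and \<open>c\<close> the next value towards 0.\<close>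
  have r: "a - b = ?r * (c - a)" if "(1 - \<eta>) * (a - b) = \<beta> * (b + c - 2 * a)" for a b c
  proof -
    have "\<beta> + 1 - \<eta> \<noteq> 0" using \<beta> \<eta> by linarith
    moreover have "(\<beta> + 1 - \<eta>) * (a - b) = \<beta> * (c - a)" using that by (simp add: algebra_simps)
    ultimately show ?thesis by (simp add: decay_rate_def field_simps)
  qed
  have pos: "?q (1 * int n) = ?q (1 * int 0) * ?r ^ n" for n
  proof (rule geometric_half_line[OF _ lim])
    show "?q (1 * int (Suc n)) - ?q (1 * int (Suc (Suc n))) = ?r * (?q (1 * int n) - ?q (1 * int (Suc n)))" for n
      using law[of "int (Suc n)"] arrivals(1)[of "int (Suc n)"] by (intro r) (simp add: add_ac)
  qed simp
  have neg: "?q (- 1 * int n) = ?q (- 1 * int 0) * ?r ^ n" for n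
  proof (rule geometric_half_line[OF _ lim])
    show "?q (- 1 * int (Suc n)) - ?q (- 1 * int (Suc (Suc n))) = ?r * (?q (- 1 * int n) - ?q (- 1 * int (Suc n)))" for n
      using law[of "- int (Suc n)"] arrivals(2)[of "- int (Suc n)"] by (intro r) (simp add: add_ac)
  qed simp
  have q: "?q k = ?q 0 * ?r ^ nat \<bar>k\<bar>" for k
    using pos[of "nat k"] neg[of "nat (- k)"] by (cases "k \<ge> 0") simp_all
  have "(?q has_sum (?q 0 * ((1 + ?r) / (1 - ?r)))) UNIV"
    by (subst q[abs_def], intro has_sum_cmult_right has_sum_two_sided_geometric)
       (use decay_rate_bounds in auto)
  moreover have "(?q has_sum \<eta>) UNIV"
    using has_sum_head_prob[of p] by (simp add: prob_length_gt)
  ultimately have "?q 0 * ((1 + ?r) / (1 - ?r)) = head0 \<beta> \<eta> * ((1 + ?r) / (1 - ?r))"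
    using head0_eq infsumI by metis
  hence q0: "?q 0 = head0 \<beta> \<eta>"
    using decay_rate_bounds by simp
  with q show "?q k = head0 \<beta> \<eta> * ?r ^ nat \<bar>k\<bar>" by metis
  \<comment> \<open>The recursions used only nonzero marks; the remaining equation at 0 determines
    \<open>x 0\<close>.\<close>
  have "(1 - \<eta>) * (head0 \<beta> \<eta> - x 0) = \<beta> * (2 * head0 \<beta> \<eta> * ?r - 2 * head0 \<beta> \<eta>)"
    using law[of 0] q[of 1] q[of "- 1"] q0 by simp
  hence "(1 - \<eta>) * x 0 = (1 - \<eta>) * head0 \<beta> \<eta> + 2 * head0 \<beta> \<eta> * (\<beta> * (1 - ?r))"
    by (simp add: algebra_simps)
  also have "\<dots> = (1 - \<eta>) * lam_formula \<beta> \<eta>"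
    by (simp add: lam_formula_def flip: decay_rate_eq) (simp add: algebra_simps)
  finally show "x 0 = lam_formula \<beta> \<eta>" using \<eta> by simp
qed

text \<open>A solution is stationary for the rates it generates, and these are forced into closed
  form; hence all solutions with the same \<open>\<eta>\<close> share their rates.\<close>

lemma solution_explicit:
  assumes sol: "solves_system \<beta> lam p" and inflow: "inflow lam p = \<eta>"
  shows "lam = lam_formula \<beta> \<eta>" and "stationary \<beta> \<eta> (arrival_rate \<beta> \<eta>) p"
proof -
  let ?x = "\<lambda>k. nu p k + lam * of_bool (k = 0)"
  have st: "stationary \<beta> \<eta> ?x p"
  proof
    show "(?x has_sum \<eta>) UNIV" using has_sum_inflow[of p lam] by (simp add: inflow)
    show "flow \<beta> ?x (pmf p) ns = 0" for ns
      using sol by (simp add: solves_system_def balance_eq_flow)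
  qed (use \<beta> \<eta> in auto)
  have x: "?x k = head_prob p (k + 1)" if "k > 0" for k using that by (simp add: nu_eq)
  have x': "?x k = head_prob p (k - 1)" if "k < 0" for k using that by (simp add: nu_eq)
  note explicit = head_prob_explicit[OF st x x']
  show lam: "lam = lam_formula \<beta> \<eta>" using explicit(2) by (simp add: nu_def)
  have "?x k = arrival_rate \<beta> \<eta> k" for k
    using explicit(1)[of "k + 1"] explicit(1)[of "k - 1"]
    by (cases k "0 :: int" rule: linorder_cases)
       (auto simp: nu_eq arrival_rate_def lam nat_add_distrib nat_one_minus)
  hence "?x = arrival_rate \<beta> \<eta>" by (rule ext)
  with st show "stationary \<beta> \<eta> (arrival_rate \<beta> \<eta>) p" by simp
qed

lemma arrival_rate_nonneg: "arrival_rate \<beta> \<eta> k \<ge> 0"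
  using head0_pos decay_rate_bounds by (simp add: arrival_rate_def lam_formula_def)

lemma has_sum_arrival_rate: "(arrival_rate \<beta> \<eta> has_sum \<eta>) UNIV"
proof -
  let ?r = "decay_rate \<beta> \<eta>" and ?q = "head0 \<beta> \<eta>"
  have "((\<lambda>k. ?q * ?r * ?r ^ nat \<bar>k\<bar>) has_sum (?q * ?r * ((1 + ?r) / (1 - ?r)))) UNIV"
    by (intro has_sum_cmult_right has_sum_two_sided_geometric) (use decay_rate_bounds in auto)
  \<comment> \<open>At mark 0 the geometric term contributes \<open>?q * ?r\<close>, while the rate
    is \<open>?q * (1 + 2 * ?r)\<close>; this family supplies the difference.\<close>
  moreover have "((\<lambda>k::int. ?q * (1 + ?r) * of_bool (k = 0)) has_sum (?q * (1 + ?r))) UNIV"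
    by (rule has_sum_finite_neutralI[of "{0}"]) auto
  ultimately have "((\<lambda>k. ?q * ?r * ?r ^ nat \<bar>k\<bar> + ?q * (1 + ?r) * of_bool (k = 0)) has_sum
      (?q * ?r * ((1 + ?r) / (1 - ?r)) + ?q * (1 + ?r))) UNIV"
    by (rule has_sum_add)
  moreover have "?q * ?r * ?r ^ nat \<bar>k\<bar> + ?q * (1 + ?r) * of_bool (k = 0) = arrival_rate \<beta> \<eta> k" for k
    by (simp add: arrival_rate_def lam_formula_def algebra_simps)
  moreover have "?q * ?r * ((1 + ?r) / (1 - ?r)) + ?q * (1 + ?r) = ?q * ((1 + ?r) / (1 - ?r))"
    using decay_rate_bounds by (simp add: field_simps)
  ultimately have "(arrival_rate \<beta> \<eta> has_sum ?q * ((1 + ?r) / (1 - ?r))) UNIV"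
    by (simp only:)
  thus ?thesis by (simp only: head0_eq)
qed

lemma stationary_head_prob:
  assumes st: "stationary \<beta> \<eta> (arrival_rate \<beta> \<eta>) p"
  shows "head_prob p k = head0 \<beta> \<eta> * decay_rate \<beta> \<eta> ^ nat \<bar>k\<bar>"
proof -
  interpret stationary \<beta> \<eta> "arrival_rate \<beta> \<eta>" p by fact
  let ?r = "decay_rate \<beta> \<eta>"
  define e where "e k = head0 \<beta> \<eta> * ?r ^ nat \<bar>k\<bar>" for k :: int
  define d where "d k = head_prob p k - e k" for k
  have e: "(1 - \<eta>) * (e k - arrival_rate \<beta> \<eta> k) = \<beta> * (e (k + 1) + e (k - 1) - 2 * e k)" for k
  proof (cases k rule: int_cases3)
    case zero
    have "(1 - \<eta>) * (e k - arrival_rate \<beta> \<eta> k) = - 2 * head0 \<beta> \<eta> * ((1 - \<eta>) * ?r)"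
      by (simp add: zero e_def arrival_rate_def lam_formula_def algebra_simps)
    also have "\<dots> = \<beta> * (e (k + 1) + e (k - 1) - 2 * e k)"
      unfolding decay_rate_eq by (simp add: zero e_def algebra_simps)
    finally show ?thesis .
  next
    case (pos n)
    then obtain m where m: "n = Suc m" by (cases n) auto
    have *: "e k = head0 \<beta> \<eta> * ?r ^ m * ?r" "e (k - 1) = head0 \<beta> \<eta> * ?r ^ m"
      "e (k + 1) = head0 \<beta> \<eta> * ?r ^ m * ?r * ?r" "arrival_rate \<beta> \<eta> k = head0 \<beta> \<eta> * ?r ^ m * ?r * ?r"
      by (simp_all add: pos m e_def arrival_rate_def nat_add_distrib)
    have "(1 - \<eta>) * (e k - arrival_rate \<beta> \<eta> k) = head0 \<beta> \<eta> * ?r ^ m * (1 - ?r) * ((1 - \<eta>) * ?r)"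
      unfolding * by (simp add: algebra_simps)
    also have "\<dots> = \<beta> * (e (k + 1) + e (k - 1) - 2 * e k)"
      unfolding decay_rate_eq * by (simp add: algebra_simps)
    finally show ?thesis .
  next
    case (neg n)
    then obtain m where m: "n = Suc m" by (cases n) auto
    have *: "e k = head0 \<beta> \<eta> * ?r ^ m * ?r" "e (k + 1) = head0 \<beta> \<eta> * ?r ^ m"
      "e (k - 1) = head0 \<beta> \<eta> * ?r ^ m * ?r * ?r" "arrival_rate \<beta> \<eta> k = head0 \<beta> \<eta> * ?r ^ m * ?r * ?r"
      by (simp_all add: neg m e_def arrival_rate_def nat_add_distrib)
    have "(1 - \<eta>) * (e k - arrival_rate \<beta> \<eta> k) = head0 \<beta> \<eta> * ?r ^ m * (1 - ?r) * ((1 - \<eta>) * ?r)"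
      unfolding * by (simp add: algebra_simps)
    also have "\<dots> = \<beta> * (e (k + 1) + e (k - 1) - 2 * e k)"
      unfolding decay_rate_eq * by (simp add: algebra_simps)
    finally show ?thesis .
  qed
  have d: "\<eta> * d k = d k - \<beta> * (d (k + 1) + d (k - 1) - 2 * d k)" for k
    using head_law[of k, folded head_prob_def] e[of k] by (simp add: d_def algebra_simps)
  \<comment> \<open>By the equation for \<open>d\<close>, the functions
    \<open>\<eta> ^ j * d k\<close> satisfy the recursion of \<open>laplace_decay\<close>; they
    decay in \<open>j\<close> because \<open>d\<close> is bounded.\<close>
  have "\<eta> ^ 0 * d k = 0"
  proof (rule laplace_decay[where \<beta> = \<beta> and B = "\<lambda>j. \<eta> ^ j * (1 + head0 \<beta> \<eta>)"])
    show "\<eta> ^ Suc j * d k = \<eta> ^ j * d k - \<beta> * (\<eta> ^ j * d (k + 1) + \<eta> ^ j * d (k - 1) - 2 * (\<eta> ^ j * d k))" for j k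
    proof -
      have "\<eta> ^ Suc j * d k = \<eta> ^ j * (\<eta> * d k)" by simp
      also have "\<dots> = \<eta> ^ j * (d k - \<beta> * (d (k + 1) + d (k - 1) - 2 * d k))"
        by (simp only: d[of k])
      finally show ?thesis by (simp add: algebra_simps)
    qed
    show "\<bar>\<eta> ^ j * d k\<bar> \<le> \<eta> ^ j * (1 + head0 \<beta> \<eta>)" for j k
    proof -
      have "?r ^ nat \<bar>k\<bar> \<le> 1" using decay_rate_bounds by (intro power_le_one) auto
      hence "0 \<le> e k" "e k \<le> head0 \<beta> \<eta>"
        using head0_pos decay_rate_bounds by (simp_all add: e_def)
      hence "\<bar>d k\<bar> \<le> 1 + head0 \<beta> \<eta>"
        using head_prob_nonneg[of p k] head_prob_le_1[of p k] by (simp add: d_def)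
      thus ?thesis using \<eta> by (simp add: abs_mult mult_left_mono)
    qed
    have "(\<lambda>j. \<eta> ^ j * (1 + head0 \<beta> \<eta>)) \<longlonglongrightarrow> 0 * (1 + head0 \<beta> \<eta>)"
      using \<eta> by (intro tendsto_intros LIMSEQ_realpow_zero) auto
    thus "(\<lambda>j. \<eta> ^ j * (1 + head0 \<beta> \<eta>)) \<longlonglongrightarrow> 0" by simp
  qed (use \<beta> in auto)
  thus ?thesis by (simp add: d_def e_def)
qed

text \<open>The head law one step outward from \<open>k\<close> equals the prescribed rate, so the
  linear system becomes the nonlinear one; symmetry holds because the head law is even.\<close>

lemma stationary_solves:
  assumes st: "stationary \<beta> \<eta> (arrival_rate \<beta> \<eta>) p"
  shows "solves_system \<beta> (lam_formula \<beta> \<eta>) p" and "inflow (lam_formula \<beta> \<eta>) p = \<eta>"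
proof -
  interpret stationary \<beta> \<eta> "arrival_rate \<beta> \<eta>" p by fact
  let ?x = "\<lambda>k. nu p k + lam_formula \<beta> \<eta> * of_bool (k = 0)"
  have "?x k = arrival_rate \<beta> \<eta> k" for k
    by (cases k "0 :: int" rule: linorder_cases)
       (auto simp: nu_eq arrival_rate_def stationary_head_prob[OF st] nat_one_minus nat_one_plus)
  hence x: "?x = arrival_rate \<beta> \<eta>" by (rule ext)
  have "nu p k = nu p (- k)" for k
    by (cases k "0 :: int" rule: linorder_cases)
       (auto simp: nu_eq stationary_head_prob[OF st] nat_one_minus nat_one_plus)
  thus "solves_system \<beta> (lam_formula \<beta> \<eta>) p"
    by (simp add: solves_system_def balance_eq_flow x flow)
  show "inflow (lam_formula \<beta> \<eta>) p = \<eta>"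
    using infsumI[OF has_sum_inflow[of p "lam_formula \<beta> \<eta>"]] by (simp add: x infsum_x)
qed

end

section \<open>Construction of a stationary law for given rates\<close>

lemma pmf_of_has_sum:
  fixes f :: "'a \<Rightarrow> real"
  assumes nonneg: "\<And>a. f a \<ge> 0" and sum: "(f has_sum 1) UNIV"
  obtains p where "\<And>a. pmf p a = f a"
proof -
  have "(\<lambda>a. norm (f a)) summable_on UNIV"
    using summable_on_iff_abs_summable_on_real[of f UNIV] has_sum_imp_summable[OF sum] by (simp only:)
  hence *: "Infinite_Set_Sum.abs_summable_on f UNIV"
    by (rule iffD1[OF abs_summable_equivalent])
  have "infsetsum f UNIV = 1"
    using infsetsum_infsum[OF *] infsumI[OF sum] by (simp only:)
  hence "(\<integral>\<^sup>+ a. ennreal (f a) \<partial>count_space UNIV) = 1"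
    using nn_integral_conv_infsetsum[OF *] nonneg by simp
  hence "pmf (embed_pmf f) a = f a" for a
    using nonneg by (intro pmf_embed_pmf) auto
  thus ?thesis by (rule that)
qed

lemma pmf_add_noise:
  fixes H :: "int pmf" and R :: "int list pmf"
  shows "((\<lambda>y. pmf H y * pmf R (map (\<lambda>n. n - y) ns)) has_sum
           pmf (map_pmf (\<lambda>(y, z). map ((+) y) z) (pair_pmf H R)) ns) UNIV"
proof -
  let ?h = "\<lambda>y. (y, map (\<lambda>n. n - y) ns)"
  have "(\<lambda>(y, z). map ((+) y) z) -` {ns} = range ?h"
    by (auto simp: o_def)
  hence "(pmf (pair_pmf H R) has_sum pmf (map_pmf (\<lambda>(y, z). map ((+) y) z) (pair_pmf H R)) ns) (range ?h)"
    using has_sum_pmf[of "pair_pmf H R" "range ?h"] by (simp add: pmf_map)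
  moreover have "inj ?h" by (auto simp: inj_on_def)
  ultimately show ?thesis
    by (subst (asm) has_sum_reindex) (auto simp: o_def pmf_pair)
qed

lemma pmf_append_one:
  "pmf (map_pmf (\<lambda>(ns, a). ns @ [a]) (pair_pmf q P)) ns =
     (if ns = [] then 0 else pmf q (butlast ns) * pmf P (last ns))"
proof (cases "ns = []")
  case True
  thus ?thesis by (auto simp: pmf_eq_0_set_pmf)
next
  case False
  have inj: "inj (\<lambda>(ns, a). ns @ [a])" by (auto simp: inj_on_def)
  show ?thesis
    using pmf_map_inj'[OF inj, of "pair_pmf q P" "(butlast ns, last ns)"] False by (simp add: pmf_pair)
qed

lemma ex_resolvent_kernel:
  fixes \<beta> :: real
  assumes \<beta>: "\<beta> > 0"
  obtains H :: "int pmf"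
  where "\<And>y. (1 + 2 * \<beta>) * pmf H y = of_bool (y = 0) + \<beta> * (pmf H (y - 1) + pmf H (y + 1))"
proof -
  \<comment> \<open>\<open>s\<close> is the square root of the discriminant of
    \<open>\<beta> * z * z - (1 + 2 * \<beta>) * z + \<beta>\<close> and \<open>\<rho>\<close> is
    the root in (0, 1). Moreover \<open>s = (1 + \<rho>) / (1 - \<rho>)\<close>, so dividing by
    \<open>s\<close> normalises the kernel.\<close>
  define s where "s = sqrt (1 + 4 * \<beta>)"
  define \<rho> where "\<rho> = (s - 1) / (s + 1)"
  have s: "s > 1" and \<beta>s: "\<beta> = (s - 1) * (s + 1) / 4"
    using \<beta> by (auto simp: s_def algebra_simps)
  have \<rho>: "0 < \<rho>" "\<rho> < 1"
    using s by (auto simp: \<rho>_def)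
  have \<rho>s: "\<rho> * (s + 1) = s - 1"
    using s by (simp add: \<rho>_def)
  have "(1 + \<rho>) * (s + 1) = 2 * s" "(1 - \<rho>) * (s + 1) = 2"
    using \<rho>s by (simp_all add: algebra_simps)
  hence "(1 + \<rho>) / (1 - \<rho>) = s"
    using \<rho> s by (simp add: field_simps)
  hence sum: "((\<lambda>y::int. \<rho> ^ nat \<bar>y\<bar>) has_sum s) UNIV"
    using has_sum_two_sided_geometric[of \<rho>] \<rho> by simp
  have "((\<lambda>y::int. 1 / s * \<rho> ^ nat \<bar>y\<bar>) has_sum (1 / s * s)) UNIV"
    by (rule has_sum_cmult_right[OF sum])
  hence "((\<lambda>y::int. 1 / s * \<rho> ^ nat \<bar>y\<bar>) has_sum 1) UNIV"
    using s by simp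
  then obtain H :: "int pmf" where H: "\<And>y. pmf H y = 1 / s * \<rho> ^ nat \<bar>y\<bar>"
    using \<rho> s by (elim pmf_of_has_sum[rotated]) auto
  have quad: "(1 + 2 * \<beta>) * \<rho> = \<beta> * (1 + \<rho> * \<rho>)"
  proof -
    have "4 * \<beta> * (1 - \<rho>) * (1 - \<rho>) = (s - 1) * ((1 - \<rho>) * (s + 1)) * (1 - \<rho>)"
      by (simp add: \<beta>s)
    also have "\<dots> = 2 * ((s - 1) * (1 - \<rho>))"
      using \<open>(1 - \<rho>) * (s + 1) = 2\<close> by simp
    also have "(s - 1) * (1 - \<rho>) = \<rho> * ((1 - \<rho>) * (s + 1))"
      unfolding \<rho>s[symmetric] by (simp add: mult_ac)
    also have "\<dots> = 2 * \<rho>"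
      using \<open>(1 - \<rho>) * (s + 1) = 2\<close> by simp
    finally show ?thesis by (simp add: algebra_simps)
  qed
  have "(1 + 2 * \<beta>) * pmf H y = of_bool (y = 0) + \<beta> * (pmf H (y - 1) + pmf H (y + 1))" for y
  proof (cases y rule: int_cases3)
    case zero
    have "2 * \<beta> * (1 - \<rho>) = (s - 1) * ((1 - \<rho>) * (s + 1)) / 2"
      by (simp add: \<beta>s)
    also have "\<dots> = s - 1"
      using \<open>(1 - \<rho>) * (s + 1) = 2\<close> by simp
    finally have "1 + 2 * \<beta> = s + 2 * \<beta> * \<rho>" by (simp add: algebra_simps)
    thus ?thesis using s by (simp add: zero H field_simps)
  next
    case (pos n)
    then obtain m where m: "n = Suc m" by (cases n) auto
    have "(1 + 2 * \<beta>) * pmf H y = 1 / s * \<rho> ^ m * ((1 + 2 * \<beta>) * \<rho>)"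
      by (simp add: H pos m nat_add_distrib)
    also have "\<dots> = \<beta> * (pmf H (y - 1) + pmf H (y + 1))"
      unfolding quad by (simp add: H pos m nat_add_distrib algebra_simps)
    finally show ?thesis by (simp add: pos m)
  next
    case (neg n)
    then obtain m where m: "n = Suc m" by (cases n) auto
    have "(1 + 2 * \<beta>) * pmf H y = 1 / s * \<rho> ^ m * ((1 + 2 * \<beta>) * \<rho>)"
      by (simp add: H neg m nat_add_distrib)
    also have "\<dots> = \<beta> * (pmf H (y - 1) + pmf H (y + 1))"
      unfolding quad by (simp add: H neg m nat_add_distrib algebra_simps)
    finally show ?thesis by (simp add: neg m)
  qed
  thus ?thesis by (rule that)
qed

text \<open>The law of the marks given that the queue has length \<open>l\<close>: a new mark of law \<open>P\<close> is appended
  to a queue of length \<open>l\<close>, and then all marks are moved by a common noise whose law is the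
  resolvent kernel \<open>(1 - \<beta>\<Delta>)\<^sup>-\<^sup>1\<close>.\<close>

primrec queue_law :: "int pmf \<Rightarrow> int pmf \<Rightarrow> nat \<Rightarrow> int list pmf" where
  "queue_law H P 0 = return_pmf []"
| "queue_law H P (Suc l) = map_pmf (\<lambda>(y, z). map ((+) y) z)
     (pair_pmf H (map_pmf (\<lambda>(ns, a). ns @ [a]) (pair_pmf (queue_law H P l) P)))"

lemma length_queue_law: "ns \<in> set_pmf (queue_law H P l) \<Longrightarrow> length ns = l"
  by (induction l arbitrary: ns) auto

text \<open>Deleting the head commutes with appending to a nonempty queue and with moving all marks
  together. This consistency makes departures from length \<open>l + 1\<close> reproduce the law at
  length \<open>l\<close>.\<close>

lemma tl_queue_law: "map_pmf tl (queue_law H P (Suc l)) = queue_law H P l"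
proof (induction l)
  case 0
  have "map_pmf tl (queue_law H P (Suc 0)) = map_pmf (\<lambda>_. []) (queue_law H P (Suc 0))"
    by (rule map_pmf_cong) (auto dest!: length_queue_law simp: length_Suc_conv simp del: queue_law.simps)
  thus ?case by simp
next
  case (Suc l)
  let ?app = "\<lambda>(ns, a). ns @ [a]" and ?Q = "queue_law H P"
  have tl_app: "map_pmf tl (map_pmf ?app (pair_pmf (?Q (Suc l)) P)) = map_pmf ?app (pair_pmf (?Q l) P)"
  proof -
    have "map_pmf tl (map_pmf ?app (pair_pmf (?Q (Suc l)) P))
        = map_pmf (\<lambda>z. ?app (apfst tl z)) (pair_pmf (?Q (Suc l)) P)"
      unfolding map_pmf_comp
      by (rule map_pmf_cong) (auto dest!: length_queue_law simp: length_Suc_conv simp del: queue_law.simps)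
    also have "\<dots> = map_pmf ?app (pair_pmf (map_pmf tl (?Q (Suc l))) P)"
      by (simp only: pair_map_pmf1 map_pmf_comp)
    finally show ?thesis by (simp only: Suc)
  qed
  let ?R = "\<lambda>l. map_pmf ?app (pair_pmf (?Q l) P)"
  have "map_pmf tl (?Q (Suc (Suc l))) = map_pmf (\<lambda>z. map ((+) (fst z)) (snd (apsnd tl z))) (pair_pmf H (?R (Suc l)))"
    by (simp add: map_pmf_comp map_tl case_prod_unfold del: queue_law.simps(2)[of H P l])
  also have "\<dots> = map_pmf (\<lambda>(y, z). map ((+) y) z) (map_pmf (apsnd tl) (pair_pmf H (?R (Suc l))))"
    by (simp add: map_pmf_comp case_prod_unfold)
  also have "map_pmf (apsnd tl) (pair_pmf H (?R (Suc l))) = pair_pmf H (map_pmf tl (?R (Suc l)))"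
    by (simp only: pair_map_pmf2)
  also have "\<dots> = pair_pmf H (?R l)"
    by (simp only: tl_app)
  finally show ?case by simp
qed

lemma infsum_queue_law_Cons: "(\<Sum>\<^sub>\<infinity>k. pmf (queue_law H P (Suc l)) (k # ns)) = pmf (queue_law H P l) ns"
proof -
  let ?Q = "queue_law H P (Suc l)"
  have "(\<Sum>\<^sub>\<infinity>k. pmf ?Q (k # ns)) = measure ?Q (range (\<lambda>k. k # ns))"
    using infsum_reindex[of "\<lambda>k. k # ns" UNIV "pmf ?Q"]
    by (simp add: inj_on_def o_def infsum_pmf del: queue_law.simps)
  \<comment> \<open>The sets can differ only in the empty list, since \<open>tl [] = []\<close>; the
    length \<open>Suc l\<close> rules it out.\<close>
  also have "\<dots> = measure ?Q (tl -` {ns})"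
  proof (rule measure_pmf.finite_measure_eq_AE)
    show "AE z in measure_pmf ?Q. (z \<in> range (\<lambda>k. k # ns)) = (z \<in> tl -` {ns})"
      unfolding AE_measure_pmf_iff
    proof
      fix z assume "z \<in> set_pmf ?Q"
      hence "length z = Suc l" by (rule length_queue_law)
      thus "(z \<in> range (\<lambda>k. k # ns)) = (z \<in> tl -` {ns})" by (cases z) auto
    qed
  qed simp_all
  also have "\<dots> = pmf (queue_law H P l) ns"
    using tl_queue_law[of H P l] by (simp add: pmf_map[symmetric] del: queue_law.simps)
  finally show ?thesis .
qed

text \<open>In the convolution with the noise, shifting the queue amounts to shifting the argument
  of \<open>H\<close>. The kernel equation then collapses the sum to the term without noise, which
  is the law just after appending.\<close>

lemma queue_law_resolvent:
  fixes \<beta> :: real and P :: "int pmf"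
  assumes H: "\<And>y. (1 + 2 * \<beta>) * pmf H y = of_bool (y = 0) + \<beta> * (pmf H (y - 1) + pmf H (y + 1))"
    and ns: "ns \<noteq> []"
  defines "Q \<equiv> queue_law H P"
  shows "(1 + 2 * \<beta>) * pmf (Q (Suc l)) ns
     = pmf (Q l) (butlast ns) * pmf P (last ns)
       + \<beta> * (pmf (Q (Suc l)) (map (\<lambda>n. n + 1) ns) + pmf (Q (Suc l)) (map (\<lambda>n. n - 1) ns))"
proof -
  let ?R = "map_pmf (\<lambda>(ns, a). ns @ [a]) (pair_pmf (Q l) P)"
  define u where "u y = pmf ?R (map (\<lambda>n. n - y) ns)" for y
  have Q: "((\<lambda>y. pmf H y * pmf ?R (map (\<lambda>n. n - y) ms)) has_sum pmf (Q (Suc l)) ms) UNIV" for ms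
    using pmf_add_noise[of H ?R ms] by (simp add: Q_def)
  have shift: "((\<lambda>y. pmf H (y + c) * u y) has_sum pmf (Q (Suc l)) (map (\<lambda>n. n + c) ns)) UNIV" for c
  proof -
    have "((\<lambda>y. pmf H y * u (y - c)) has_sum pmf (Q (Suc l)) (map (\<lambda>n. n + c) ns)) (range (\<lambda>y. y + c))"
      using Q[of "map (\<lambda>n. n + c) ns"] surjI[of "\<lambda>y. y + c" "\<lambda>y. y - c"]
      by (simp add: u_def o_def algebra_simps)
    thus ?thesis
      by (subst (asm) has_sum_reindex) (auto simp: inj_on_def o_def)
  qed
  have "((\<lambda>y. (1 + 2 * \<beta>) * (pmf H (y + 0) * u y)
            - \<beta> * (pmf H (y + 1) * u y + pmf H (y + - 1) * u y)) has_sum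
          ((1 + 2 * \<beta>) * pmf (Q (Suc l)) (map (\<lambda>n. n + 0) ns)
            - \<beta> * (pmf (Q (Suc l)) (map (\<lambda>n. n + 1) ns) + pmf (Q (Suc l)) (map (\<lambda>n. n + - 1) ns)))) UNIV"
    by (intro has_sum_minus has_sum_add has_sum_cmult_right shift)
  moreover have "(1 + 2 * \<beta>) * (pmf H (y + 0) * u y)
      - \<beta> * (pmf H (y + 1) * u y + pmf H (y + - 1) * u y) = of_bool (y = 0) * u y" for y
  proof -
    have "(1 + 2 * \<beta>) * (pmf H (y + 0) * u y) - \<beta> * (pmf H (y + 1) * u y + pmf H (y + - 1) * u y)
        = ((1 + 2 * \<beta>) * pmf H y - \<beta> * (pmf H (y - 1) + pmf H (y + 1))) * u y"
      by (simp add: algebra_simps)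
    also have "\<dots> = of_bool (y = 0) * u y" by (simp only: H) simp
    finally show ?thesis .
  qed
  ultimately have "((\<lambda>y. of_bool (y = 0) * u y) has_sum
          ((1 + 2 * \<beta>) * pmf (Q (Suc l)) ns
            - \<beta> * (pmf (Q (Suc l)) (map (\<lambda>n. n + 1) ns) + pmf (Q (Suc l)) (map (\<lambda>n. n - 1) ns)))) UNIV"
    by (simp only:) simp
  moreover have "((\<lambda>y. of_bool (y = 0) * u y) has_sum u 0) UNIV"
    by (rule has_sum_finite_neutralI[of "{0}"]) auto
  ultimately have "(1 + 2 * \<beta>) * pmf (Q (Suc l)) ns
            - \<beta> * (pmf (Q (Suc l)) (map (\<lambda>n. n + 1) ns) + pmf (Q (Suc l)) (map (\<lambda>n. n - 1) ns)) = u 0"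
    by (rule has_sum_unique)
  moreover have "u 0 = pmf (Q l) (butlast ns) * pmf P (last ns)"
    using ns by (simp add: u_def pmf_append_one)
  ultimately show ?thesis by simp
qed

text \<open>With a geometric length of ratio \<open>\<eta>\<close>, the loss through arrivals
  cancels the gain from departures out of longer queues. What remains on each positive length is the
  resolvent identity times a common factor.\<close>

lemma stationary_exists:
  fixes P :: "int pmf"
  assumes \<beta>: "\<beta> > 0" and \<eta>: "0 < \<eta>" "\<eta> < 1"
  obtains p where "stationary \<beta> \<eta> (\<lambda>k. \<eta> * pmf P k) p"
proof -
  obtain H :: "int pmf"
    where H: "\<And>y. (1 + 2 * \<beta>) * pmf H y = of_bool (y = 0) + \<beta> * (pmf H (y - 1) + pmf H (y + 1))"
    using ex_resolvent_kernel[OF \<beta>] by blast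
  define Q where "Q = queue_law H P"
  define p where "p = bind_pmf (geometric_pmf (1 - \<eta>)) Q"
  have p: "pmf p ns = (1 - \<eta>) * \<eta> ^ length ns * pmf (Q (length ns)) ns" for ns
  proof -
    have "pmf p ns = (\<Sum>l\<in>{length ns}. pmf (Q l) ns * pmf (geometric_pmf (1 - \<eta>)) l)"
      unfolding p_def pmf_bind
      by (rule integral_measure_pmf_real)
         (auto simp: Q_def simp del: queue_law.simps dest!: length_queue_law simp flip: set_pmf_iff)
    thus ?thesis using \<eta> by (simp add: pmf_geometric)
  qed
  have has_sum_x: "((\<lambda>k. \<eta> * pmf P k) has_sum \<eta>) UNIV"
    using has_sum_cmult_right[OF has_sum_pmf[of P UNIV], of \<eta>] by simp
  have "flow \<beta> (\<lambda>k. \<eta> * pmf P k) (pmf p) ns = 0" for ns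
  proof -
    let ?l = "length ns"
    have heads: "(\<Sum>\<^sub>\<infinity>k. pmf p (k # ns)) = (1 - \<eta>) * \<eta> ^ Suc ?l * pmf (Q ?l) ns"
      by (simp add: p infsum_cmult_right' Q_def infsum_queue_law_Cons del: queue_law.simps)
    show ?thesis
    proof (cases "ns = []")
      case True
      thus ?thesis
        using heads infsumI[OF has_sum_x] by (simp add: flow_def p)
    next
      case False
      then obtain l where l: "?l = Suc l" by (cases ns) auto
      have "flow \<beta> (\<lambda>k. \<eta> * pmf P k) (pmf p) ns = (1 - \<eta>) * \<eta> ^ Suc l *
          (pmf (Q l) (butlast ns) * pmf P (last ns)
            + \<beta> * (pmf (Q (Suc l)) (map (\<lambda>n. n + 1) ns) + pmf (Q (Suc l)) (map (\<lambda>n. n - 1) ns))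
            - (1 + 2 * \<beta>) * pmf (Q (Suc l)) ns)"
        using heads False infsumI[OF has_sum_x]
        by (simp add: flow_def p l algebra_simps)
      also have "\<dots> = 0"
        unfolding Q_def queue_law_resolvent[OF H False] by simp
      finally show ?thesis .
    qed
  qed
  hence "stationary \<beta> \<eta> (\<lambda>k. \<eta> * pmf P k) p"
    using \<beta> \<eta> has_sum_x by unfold_locales
  thus ?thesis by (rule that)
qed

section \<open>The closed form of \<open>lambda_of\<close> and its two branches\<close>

lemma lambda_of_eq:
  assumes \<beta>: "\<beta> > 0" and \<eta>: "0 < \<eta>" "\<eta> < 1"
  shows "lambda_of \<beta> \<eta> = lam_formula \<beta> \<eta>"
proof -
  \<comment> \<open>Dividing the rates by their total mass \<open>\<eta>\<close> gives the law
    \<open>P\<close> of an arriving mark.\<close>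
  have "((\<lambda>k. 1 / \<eta> * arrival_rate \<beta> \<eta> k) has_sum (1 / \<eta> * \<eta>)) UNIV"
    by (intro has_sum_cmult_right has_sum_arrival_rate assms)
  hence "((\<lambda>k. 1 / \<eta> * arrival_rate \<beta> \<eta> k) has_sum 1) UNIV"
    using \<eta> by simp
  then obtain P :: "int pmf" where "\<And>k. pmf P k = 1 / \<eta> * arrival_rate \<beta> \<eta> k"
    using pmf_of_has_sum[of "\<lambda>k. 1 / \<eta> * arrival_rate \<beta> \<eta> k"] arrival_rate_nonneg[OF assms] \<eta>
    by (metis divide_nonneg_pos mult_nonneg_nonneg zero_le_one)
  hence P: "(\<lambda>k. \<eta> * pmf P k) = arrival_rate \<beta> \<eta>"
    using \<eta> by (simp add: fun_eq_iff)
  obtain p where p: "stationary \<beta> \<eta> (arrival_rate \<beta> \<eta>) p"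
    using stationary_exists[OF assms, of P] unfolding P by blast
  have "solution_pair \<beta> \<eta> = (lam_formula \<beta> \<eta>, p)"
    unfolding solution_pair_def
  proof (rule the_equality)
    show "solves_system \<beta> (fst (lam_formula \<beta> \<eta>, p)) (snd (lam_formula \<beta> \<eta>, p)) \<and>
        inflow (fst (lam_formula \<beta> \<eta>, p)) (snd (lam_formula \<beta> \<eta>, p)) = \<eta>"
      using stationary_solves[OF assms p] by simp
  next
    fix z assume z: "solves_system \<beta> (fst z) (snd z) \<and> inflow (fst z) (snd z) = \<eta>"
    have "fst z = lam_formula \<beta> \<eta>" "stationary \<beta> \<eta> (arrival_rate \<beta> \<eta>) (snd z)"
      using solution_explicit[OF assms] z by blast+
    moreover from this(2) p have "snd z = p"
      by (rule stationary_unique) (rule arrival_rate_nonneg[OF assms])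
    ultimately show "z = (lam_formula \<beta> \<eta>, p)" by (metis prod.collapse)
  qed
  thus ?thesis by (simp add: lambda_of_def)
qed

text \<open>This bound forces \<open>\<eta>\<close> towards an end point when the value is small. It
  combines \<open>1 - \<eta> + 2 * \<beta> \<le> 1 + 2 * \<beta>\<close> with
  \<open>head0 \<beta> \<eta> \<le> lam_formula \<beta> \<eta>\<close>.\<close>

lemma lam_formula_ge:
  assumes \<beta>: "\<beta> > 0" and \<eta>: "0 < \<eta>" "\<eta> < 1"
  shows "\<eta> * (1 - \<eta>) \<le> (1 + 2 * \<beta>) * lam_formula \<beta> \<eta>"
proof -
  have "\<eta> * (1 - \<eta>) = (1 - \<eta> + 2 * \<beta>) * head0 \<beta> \<eta>"
    using assms by (simp add: head0_def)
  also have "\<dots> \<le> (1 + 2 * \<beta>) * lam_formula \<beta> \<eta>"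
    using head0_pos[OF assms] decay_rate_bounds[OF assms] assms
    by (intro mult_mono) (auto simp: lam_formula_def)
  finally show ?thesis .
qed

lemma continuous_on_lam_formula:
  assumes "\<beta> > 0"
  shows "continuous_on {0..1} (lam_formula \<beta>)"
  unfolding lam_formula_def head0_def decay_rate_def
  using assms by (intro continuous_intros) auto

theorem proposition16:
  fixes \<beta> :: real
  assumes "\<beta> > 0"
  shows "\<exists>lam\<^sub>p > 0. \<exists>(\<eta>\<^sub>m :: real \<Rightarrow> real) (\<eta>\<^sub>p :: real \<Rightarrow> real).
           (\<forall>lam. 0 < lam \<and> lam < lam\<^sub>p \<longrightarrow>
              \<eta>\<^sub>m lam \<in> {0<..<1} \<and> \<eta>\<^sub>p lam \<in> {0<..<1} \<and> \<eta>\<^sub>m lam \<noteq> \<eta>\<^sub>p lam \<and>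
              lambda_of \<beta> (\<eta>\<^sub>m lam) = lam \<and> lambda_of \<beta> (\<eta>\<^sub>p lam) = lam) \<and>
           (\<eta>\<^sub>m \<longlongrightarrow> 0) (at_right 0) \<and> (\<eta>\<^sub>p \<longlongrightarrow> 1) (at_right 0)"
proof -
  let ?f = "lam_formula \<beta>"
  let ?C = "2 * (1 + 2 * \<beta>)"
  \<comment> \<open>The closed formula extends to the end points and vanishes there, which gives
    boundary values for the intermediate value theorem.\<close>
  have f01: "?f 0 = 0" "?f 1 = 0"
    by (simp_all add: lam_formula_def head0_def)
  have f_ge: "\<eta> * (1 - \<eta>) \<le> (1 + 2 * \<beta>) * ?f \<eta>" if "0 < \<eta>" "\<eta> < 1" for \<eta>
    by (rule lam_formula_ge[OF assms that])
  have cont: "continuous_on {0..1/2} ?f" "continuous_on {1/2..1} ?f"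
    using continuous_on_lam_formula[OF assms] by (auto elim: continuous_on_subset)
  \<comment> \<open>The value at 1/2 serves as the threshold: any smaller positive
    \<open>lam\<close> lies between it and the value 0 at either end point.\<close>
  have top: "?f (1/2) > 0"
    using head0_pos[OF assms, of "1/2"] decay_rate_bounds[OF assms, of "1/2"] by (simp add: lam_formula_def)
  \<comment> \<open>Choosing from disjoint open halves keeps the two branches different.\<close>
  define \<eta>m where "\<eta>m lam = (SOME \<eta>. \<eta> \<in> {0<..<1/2} \<and> ?f \<eta> = lam)" for lam
  define \<eta>p where "\<eta>p lam = (SOME \<eta>. \<eta> \<in> {1/2<..<1} \<and> ?f \<eta> = lam)" for lam
  have \<eta>m: "\<eta>m lam \<in> {0<..<1/2} \<and> ?f (\<eta>m lam) = lam" if lam: "0 < lam" "lam < ?f (1/2)" for lam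
  proof -
    obtain \<eta> where \<eta>: "0 \<le> \<eta>" "\<eta> \<le> 1/2" "?f \<eta> = lam"
      using IVT'[of ?f 0 lam "1/2"] cont f01 lam by auto
    moreover have "\<eta> \<noteq> 0" "\<eta> \<noteq> 1/2" using \<eta>(3) f01 lam by (metis less_irrefl)+
    ultimately have "\<eta> \<in> {0<..<1/2} \<and> ?f \<eta> = lam" by auto
    thus ?thesis unfolding \<eta>m_def by (rule someI)
  qed
  have \<eta>p: "\<eta>p lam \<in> {1/2<..<1} \<and> ?f (\<eta>p lam) = lam" if lam: "0 < lam" "lam < ?f (1/2)" for lam
  proof -
    obtain \<eta> where \<eta>: "1/2 \<le> \<eta>" "\<eta> \<le> 1" "?f \<eta> = lam"
      using IVT2'[of ?f 1 lam "1/2"] cont f01 lam by auto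
    moreover have "\<eta> \<noteq> 1" "\<eta> \<noteq> 1/2" using \<eta>(3) f01 lam by (metis less_irrefl)+
    ultimately have "\<eta> \<in> {1/2<..<1} \<and> ?f \<eta> = lam" by auto
    thus ?thesis unfolding \<eta>p_def by (rule someI)
  qed
  have near: "\<forall>\<^sub>F lam in at_right 0. 0 < lam \<and> lam < ?f (1/2)"
    using top by (auto simp: eventually_at_right_field intro!: exI[of _ "?f (1/2)"])
  have \<eta>m_le: "\<eta>m lam \<le> ?C * lam" if lam: "0 < lam" "lam < ?f (1/2)" for lam
  proof -
    \<comment> \<open>On the lower half the factor \<open>1 - \<eta>m lam\<close> is at least 1/2,
      whence the 2 in \<open>?C\<close>; the upper half is symmetric.\<close>
    have "\<eta>m lam * (1/2) \<le> \<eta>m lam * (1 - \<eta>m lam)"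
      using \<eta>m[OF lam] by (intro mult_left_mono) auto
    also have "\<dots> \<le> (1 + 2 * \<beta>) * lam" using f_ge[of "\<eta>m lam"] \<eta>m[OF lam] by auto
    finally show ?thesis by (simp add: algebra_simps)
  qed
  have \<eta>p_ge: "1 - ?C * lam \<le> \<eta>p lam" if lam: "0 < lam" "lam < ?f (1/2)" for lam
  proof -
    have "1/2 * (1 - \<eta>p lam) \<le> \<eta>p lam * (1 - \<eta>p lam)"
      using \<eta>p[OF lam] by (intro mult_right_mono) auto
    also have "\<dots> \<le> (1 + 2 * \<beta>) * lam" using f_ge[of "\<eta>p lam"] \<eta>p[OF lam] by auto
    finally show ?thesis by (simp add: algebra_simps)
  qed
  have lim0: "((\<lambda>lam. ?C * lam) \<longlongrightarrow> 0) (at_right 0)" and lim1: "((\<lambda>lam. 1 - ?C * lam) \<longlongrightarrow> 1) (at_right 0)"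
    by (auto intro!: tendsto_eq_intros)
  have "(\<eta>m \<longlongrightarrow> 0) (at_right 0)"
  proof (rule tendsto_sandwich[OF _ _ tendsto_const lim0])
    show "\<forall>\<^sub>F lam in at_right 0. 0 \<le> \<eta>m lam"
      using near by eventually_elim (use \<eta>m in force)
    show "\<forall>\<^sub>F lam in at_right 0. \<eta>m lam \<le> ?C * lam"
      using near by eventually_elim (use \<eta>m_le in blast)
  qed
  moreover have "(\<eta>p \<longlongrightarrow> 1) (at_right 0)"
  proof (rule tendsto_sandwich[OF _ _ lim1 tendsto_const])
    show "\<forall>\<^sub>F lam in at_right 0. 1 - ?C * lam \<le> \<eta>p lam"
      using near by eventually_elim (use \<eta>p_ge in blast)
    show "\<forall>\<^sub>F lam in at_right 0. \<eta>p lam \<le> 1"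
      using near by eventually_elim (use \<eta>p in force)
  qed
  moreover have "\<eta>m lam \<in> {0<..<1} \<and> \<eta>p lam \<in> {0<..<1} \<and> \<eta>m lam \<noteq> \<eta>p lam \<and>
      lambda_of \<beta> (\<eta>m lam) = lam \<and> lambda_of \<beta> (\<eta>p lam) = lam"
    if "0 < lam" "lam < ?f (1/2)" for lam
  proof -
    have 1: "\<eta>m lam \<in> {0<..<1}" "\<eta>p lam \<in> {0<..<1}" "\<eta>m lam < \<eta>p lam"
      using \<eta>m[OF that] \<eta>p[OF that] by auto
    thus ?thesis
      using \<eta>m[OF that] \<eta>p[OF that] lambda_of_eq[OF assms, of "\<eta>m lam"] lambda_of_eq[OF assms, of "\<eta>p lam"] by simp
  qed
  ultimately show ?thesis using top by blast
qed

end
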